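(* Let $a\in\mathcal E_n'$, let $\varepsilon\in\{1,-1\}$, and consider $(a,\varepsilon a)\in\mathcal A_{n+1}$ (for which $\chi=\gamma_n\frac{n(a)}{n(\varepsilon a)}=\gamma_n$). Then $(a,\varepsilon a)$ is a zero divisor in $\mathcal A_{n+1}$ if and only if $\chi=\gamma_n=1$, and in this case $(a,\varepsilon a)$ is orthogonal to itself and to all $(b,-\varepsilon b)$ such that $b\in\mathcal E_n'\setminus\{a\}$.
   Context: Real Cayley–Dickson algebras: $\mathcal A_0=\mathbb R$ with trivial involution. Given parameters $\gamma_0,\gamma_1,\dots\in\{\pm1\}$ (the paper's normalization of nonzero real parameters), $\mathcal A_{k+1}=\mathcal A_k\times\mathcal A_k$ with componentwise addition and real scaling, product $(a,b)(c,d)=(ac+\gamma_k\bar d b,\ da+b\bar c)$ and involution $\overline{(a,b)}=(\bar a,-b)$. The norm is $n(a)=a\bar a\in\mathbb R$. Standard basis: $e^{(0)}_0=1$; $e^{(k+1)}_j=(e^{(k)}_j,0)$ for $0\le j<2^k$ and $e^{(k+1)}_j=(0,e^{(k)}_{j-2^k})$ for $2^k\le j<2^{k+1}$. $\mathcal E_n'=\{e^{(n)}_1,\dots,e^{(n)}_{2^n-1}\}$. Elements $x,y$ are orthogonal if $xy=yx=0$. A zero divisor is a nonzero $x$ such that $xy=0$ or $yx=0$ for some $y\ne0$. *)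

theory Defs
  imports Complex_Main
begin

text \<open>
  The level \<open>n\<close> varies, so all algebras \<open>A\<^sub>0, A\<^sub>1, \<dots>\<close> live in one type of binary trees;
  the elements of \<open>A\<^sub>n\<close> are the trees that are complete of depth \<open>n\<close>. Applied to trees
  of the wrong shape, the operations have unspecified values.
\<close>

datatype cd = Scalar real | Couple cd cd

primrec cd_carrier :: "nat \<Rightarrow> cd set" where
  "cd_carrier 0 = range Scalar"
| "cd_carrier (Suc k) = {Couple a b |a b. a \<in> cd_carrier k \<and> b \<in> cd_carrier k}"

fun cd_add :: "cd \<Rightarrow> cd \<Rightarrow> cd" where
  "cd_add (Scalar x) (Scalar y) = Scalar (x + y)"
| "cd_add (Couple a b) (Couple c d) = Couple (cd_add a c) (cd_add b d)"

primrec cd_scale :: "real \<Rightarrow> cd \<Rightarrow> cd" where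
  "cd_scale r (Scalar x) = Scalar (r * x)"
| "cd_scale r (Couple a b) = Couple (cd_scale r a) (cd_scale r b)"

primrec cd_conj :: "cd \<Rightarrow> cd" where
  "cd_conj (Scalar x) = Scalar x"
| "cd_conj (Couple a b) = Couple (cd_conj a) (cd_scale (- 1) b)"

text \<open>The level is an argument of the product because it selects the parameter \<open>\<gamma> k\<close>.\<close>

fun cd_mult :: "(nat \<Rightarrow> real) \<Rightarrow> nat \<Rightarrow> cd \<Rightarrow> cd \<Rightarrow> cd" where
  "cd_mult \<gamma> 0 (Scalar x) (Scalar y) = Scalar (x * y)"
| "cd_mult \<gamma> (Suc k) (Couple a b) (Couple c d) =
     Couple (cd_add (cd_mult \<gamma> k a c) (cd_scale (\<gamma> k) (cd_mult \<gamma> k (cd_conj d) b)))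
            (cd_add (cd_mult \<gamma> k d a) (cd_mult \<gamma> k b (cd_conj c)))"

primrec cd_zero :: "nat \<Rightarrow> cd" where
  "cd_zero 0 = Scalar 0"
| "cd_zero (Suc k) = Couple (cd_zero k) (cd_zero k)"

text \<open>Meaningful for \<open>j < 2 ^ n\<close> only.\<close>

primrec cd_basis :: "nat \<Rightarrow> nat \<Rightarrow> cd" where
  "cd_basis 0 j = Scalar 1"
| "cd_basis (Suc k) j =
     (if j < 2 ^ k then Couple (cd_basis k j) (cd_zero k)
      else Couple (cd_zero k) (cd_basis k (j - 2 ^ k)))"

definition cd_imag_basis :: "nat \<Rightarrow> cd set" where
  "cd_imag_basis n = cd_basis n ` {1..<2 ^ n}"

text \<open>
  The real number \<open>n(a)\<close> for which \<open>a\<close> times its conjugate is \<open>n(a)\<close> times the unit \<open>cd_basis n 0\<close>.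
\<close>

definition cd_norm :: "(nat \<Rightarrow> real) \<Rightarrow> nat \<Rightarrow> cd \<Rightarrow> real" where
  "cd_norm \<gamma> n a = (THE r. cd_mult \<gamma> n a (cd_conj a) = cd_scale r (cd_basis n 0))"

text \<open>The invariant of an element \<open>Couple a b\<close> of level \<open>n + 1\<close>.\<close>

definition cd_chi :: "(nat \<Rightarrow> real) \<Rightarrow> nat \<Rightarrow> cd \<Rightarrow> cd \<Rightarrow> real" where
  "cd_chi \<gamma> n a b = \<gamma> n * (cd_norm \<gamma> n a / cd_norm \<gamma> n b)"

definition cd_orthogonal :: "(nat \<Rightarrow> real) \<Rightarrow> nat \<Rightarrow> cd \<Rightarrow> cd \<Rightarrow> bool" where
  "cd_orthogonal \<gamma> n x y \<longleftrightarrow> cd_mult \<gamma> n x y = cd_zero n \<and> cd_mult \<gamma> n y x = cd_zero n"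

definition cd_zero_divisor :: "(nat \<Rightarrow> real) \<Rightarrow> nat \<Rightarrow> cd \<Rightarrow> bool" where
  "cd_zero_divisor \<gamma> n x \<longleftrightarrow>
     x \<in> cd_carrier n \<and> x \<noteq> cd_zero n \<and>
     (\<exists>y \<in> cd_carrier n. y \<noteq> cd_zero n \<and>
        (cd_mult \<gamma> n x y = cd_zero n \<or> cd_mult \<gamma> n y x = cd_zero n))"

end

theory Submission
  imports Defs
begin

text \<open>
  Left and right multiplication by a basis element \<open>e\<close> commute, and both square to
  \<open>\<mu> = \<plusminus>1\<close>; this passes from \<open>e\<close> to \<open>(e, 0)\<close> and \<open>(0, e)\<close>, although
  the algebras themselves are not alternative. Distinct imaginary basis elements anticommute, which
  gives the orthogonality relations when \<open>\<gamma>\<^sub>n = 1\<close>. When \<open>\<gamma>\<^sub>n = -1\<close>, an annihilator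
  of \<open>(a, \<epsilon>a)\<close> yields \<open>c\<close>, \<open>d\<close> with \<open>ac = \<epsilon>(da)\<close> and \<open>ca = -\<epsilon>(ad)\<close>. Then
  \<open>a(ca) = -\<epsilon>\<mu>d\<close> and \<open>(ac)a = \<epsilon>\<mu>d\<close> agree, so \<open>d = 0\<close> and hence \<open>c = 0\<close>.
\<close>

section \<open>Carriers, linear structure and involution, level by level\<close>

lemma cd_carrier_SucE:
  assumes "x \<in> cd_carrier (Suc n)"
  obtains a b where "x = Couple a b" "a \<in> cd_carrier n" "b \<in> cd_carrier n"
  using assms by auto

lemma cd_zero_carrier [simp]: "cd_zero n \<in> cd_carrier n"
  by (induction n) auto

lemma cd_basis_carrier [simp]: "cd_basis n j \<in> cd_carrier n"
  by (induction n arbitrary: j) auto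

lemma cd_add_carrier [simp]:
  "\<lbrakk>x \<in> cd_carrier n; y \<in> cd_carrier n\<rbrakk> \<Longrightarrow> cd_add x y \<in> cd_carrier n"
  by (induction n arbitrary: x y) fastforce+

lemma cd_scale_carrier [simp]: "x \<in> cd_carrier n \<Longrightarrow> cd_scale r x \<in> cd_carrier n"
  by (induction n arbitrary: x) fastforce+

lemma cd_conj_carrier [simp]: "x \<in> cd_carrier n \<Longrightarrow> cd_conj x \<in> cd_carrier n"
  by (induction n arbitrary: x) fastforce+

lemma cd_mult_carrier [simp]:
  "\<lbrakk>x \<in> cd_carrier n; y \<in> cd_carrier n\<rbrakk> \<Longrightarrow> cd_mult \<gamma> n x y \<in> cd_carrier n"
proof (induction n arbitrary: x y)
  case (Suc n)
  then show ?case by (elim cd_carrier_SucE) simp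
qed auto

lemma cd_add_commute:
  "\<lbrakk>x \<in> cd_carrier n; y \<in> cd_carrier n\<rbrakk> \<Longrightarrow> cd_add x y = cd_add y x"
  by (induction n arbitrary: x y) fastforce+

lemma cd_add_zero_right [simp]: "x \<in> cd_carrier n \<Longrightarrow> cd_add x (cd_zero n) = x"
  by (induction n arbitrary: x) fastforce+

lemma cd_add_zero_left [simp]: "x \<in> cd_carrier n \<Longrightarrow> cd_add (cd_zero n) x = x"
  by (induction n arbitrary: x) fastforce+

lemma cd_scale_one [simp]: "cd_scale 1 x = x"
  by (induction x) auto

lemma cd_scale_scale [simp]: "cd_scale r (cd_scale s x) = cd_scale (r * s) x"
  by (induction x) auto

lemma cd_scale_zero [simp]: "cd_scale r (cd_zero n) = cd_zero n"
  by (induction n) auto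

lemma cd_conj_zero [simp]: "cd_conj (cd_zero n) = cd_zero n"
  by (induction n) auto

lemma cd_conj_scale [simp]: "cd_conj (cd_scale r x) = cd_scale r (cd_conj x)"
  by (induction x) auto

lemma cd_conj_conj [simp]: "cd_conj (cd_conj x) = x"
  by (induction x) auto

lemma cd_scale_add:
  "\<lbrakk>x \<in> cd_carrier n; y \<in> cd_carrier n\<rbrakk> \<Longrightarrow>
     cd_scale r (cd_add x y) = cd_add (cd_scale r x) (cd_scale r y)"
proof (induction n arbitrary: x y)
  case 0
  then show ?case by (auto simp: algebra_simps)
next
  case (Suc n)
  then show ?case by (elim cd_carrier_SucE) simp
qed

lemma cd_conj_add:
  "\<lbrakk>x \<in> cd_carrier n; y \<in> cd_carrier n\<rbrakk> \<Longrightarrow>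
     cd_conj (cd_add x y) = cd_add (cd_conj x) (cd_conj y)"
proof (induction n arbitrary: x y)
  case (Suc n)
  then show ?case by (elim cd_carrier_SucE) (simp add: cd_scale_add)
qed auto

text \<open>Scaling by -1 plays the role of the negative. This form turns each vanishing coordinate
  of a product into an equation between two products one level down.\<close>

lemma cd_add_eq_zero_iff:
  "\<lbrakk>x \<in> cd_carrier n; y \<in> cd_carrier n\<rbrakk> \<Longrightarrow>
     cd_add x y = cd_zero n \<longleftrightarrow> x = cd_scale (- 1) y"
proof (induction n arbitrary: x y)
  case 0
  then show ?case by auto
next
  case (Suc n)
  then show ?case by (elim cd_carrier_SucE) simp
qed

lemma cd_scale_eq_zero_iff:
  "x \<in> cd_carrier n \<Longrightarrow> cd_scale r x = cd_zero n \<longleftrightarrow> r = 0 \<or> x = cd_zero n"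
proof (induction n arbitrary: x)
  case (Suc n)
  then show ?case by (elim cd_carrier_SucE) auto
qed auto

lemma cd_scale_eq_iff:
  "\<lbrakk>x \<in> cd_carrier n; x \<noteq> cd_zero n\<rbrakk> \<Longrightarrow> cd_scale r x = cd_scale s x \<longleftrightarrow> r = s"
proof (induction n arbitrary: x)
  case (Suc n)
  then show ?case by (elim cd_carrier_SucE) auto
qed auto

lemma cd_basis_nonzero: "cd_basis n j \<noteq> cd_zero n"
  by (induction n arbitrary: j) auto

section \<open>Homogeneity, conjugation and unit of the product\<close>

lemma cd_mult_scale_left [simp]:
  "\<lbrakk>x \<in> cd_carrier n; y \<in> cd_carrier n\<rbrakk> \<Longrightarrow>
     cd_mult \<gamma> n (cd_scale r x) y = cd_scale r (cd_mult \<gamma> n x y)"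
  and cd_mult_scale_right [simp]:
  "\<lbrakk>x \<in> cd_carrier n; y \<in> cd_carrier n\<rbrakk> \<Longrightarrow>
     cd_mult \<gamma> n x (cd_scale r y) = cd_scale r (cd_mult \<gamma> n x y)"
\<comment> \<open>Both sides need one joint induction: in the term
  \<open>cd_mult \<gamma> k (cd_conj d) b\<close> of the product, part of the right factor stands on
  the left and vice versa.\<close>
proof (induction n arbitrary: x y)
  case (Suc n)
  {
    case 1
    then show ?case
      by (elim cd_carrier_SucE) (simp add: Suc.IH cd_scale_add[where n = n] mult.commute)
  next
    case 2
    then show ?case
      by (elim cd_carrier_SucE) (simp add: Suc.IH cd_scale_add[where n = n] mult.commute)
  }
qed auto

lemma cd_mult_zero [simp]:
  assumes "x \<in> cd_carrier n"
  shows "cd_mult \<gamma> n x (cd_zero n) = cd_zero n" "cd_mult \<gamma> n (cd_zero n) x = cd_zero n"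
proof -
  \<comment> \<open>Writing zero as 0 times itself reduces the claim to homogeneity.\<close>
  have z: "cd_scale 0 (cd_zero n) = cd_zero n" by simp
  have "cd_mult \<gamma> n x (cd_scale 0 (cd_zero n)) = cd_zero n"
    using assms by (subst cd_mult_scale_right) (simp_all add: cd_scale_eq_zero_iff)
  then show "cd_mult \<gamma> n x (cd_zero n) = cd_zero n" unfolding z .
  have "cd_mult \<gamma> n (cd_scale 0 (cd_zero n)) x = cd_zero n"
    using assms by (subst cd_mult_scale_left) (simp_all add: cd_scale_eq_zero_iff)
  then show "cd_mult \<gamma> n (cd_zero n) x = cd_zero n" unfolding z .
qed

lemma cd_conj_mult:
  "\<lbrakk>x \<in> cd_carrier n; y \<in> cd_carrier n\<rbrakk> \<Longrightarrow>
     cd_conj (cd_mult \<gamma> n x y) = cd_mult \<gamma> n (cd_conj y) (cd_conj x)"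
proof (induction n arbitrary: x y)
  case (Suc n)
  then show ?case
    by (elim cd_carrier_SucE)
      (simp add: cd_scale_add[where n = n] cd_conj_add[where n = n] cd_add_commute[where n = n])
qed auto

lemma cd_conj_one [simp]: "cd_conj (cd_basis n 0) = cd_basis n 0"
  by (induction n) auto

lemma cd_mult_one [simp]:
  "x \<in> cd_carrier n \<Longrightarrow> cd_mult \<gamma> n (cd_basis n 0) x = x"
  "x \<in> cd_carrier n \<Longrightarrow> cd_mult \<gamma> n x (cd_basis n 0) = x"
proof (induction n arbitrary: x)
  case (Suc n)
  {
    case 1
    then show ?case by (elim cd_carrier_SucE) (simp add: Suc.IH)
  next
    case 2
    then show ?case by (elim cd_carrier_SucE) (simp add: Suc.IH)
  }
qed auto

section \<open>Basis elements and multiplication by them\<close>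

lemma cd_conj_basis:
  "\<lbrakk>0 < j; j < 2 ^ n\<rbrakk> \<Longrightarrow> cd_conj (cd_basis n j) = cd_scale (- 1) (cd_basis n j)"
  by (induction n arbitrary: j) auto

text \<open>If exactly one factor lies in the second half, the sign is just the conjugate of the
  imaginary factor in the first half. Only pairs from the same half use the induction
  hypothesis.\<close>

lemma cd_basis_anticommute:
  assumes "0 < i" "i < 2 ^ n" "0 < j" "j < 2 ^ n" "i \<noteq> j"
  shows "cd_mult \<gamma> n (cd_basis n i) (cd_basis n j) =
    cd_scale (- 1) (cd_mult \<gamma> n (cd_basis n j) (cd_basis n i))"
  using assms
proof (induction n arbitrary: i j)
  case (Suc n)
  consider "i < 2 ^ n" "j < 2 ^ n" | "i < 2 ^ n" "2 ^ n \<le> j" | "2 ^ n \<le> i" "j < 2 ^ n"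
    | "2 ^ n \<le> i" "2 ^ n \<le> j" by linarith
  then show ?case
  proof cases
    case 1
    then show ?thesis using Suc.prems Suc.IH[of i j] by simp
  next
    case 2
    then show ?thesis using Suc.prems by (simp add: cd_conj_basis)
  next
    case 3
    then show ?thesis using Suc.prems by (simp add: cd_conj_basis)
  next
    case 4
    define k l where "k = i - 2 ^ n" and "l = j - 2 ^ n"
    have kl: "k < 2 ^ n" "l < 2 ^ n" "k \<noteq> l"
      using 4 Suc.prems by (auto simp: k_def l_def)
    have "cd_mult \<gamma> n (cd_conj (cd_basis n l)) (cd_basis n k) =
      cd_scale (- 1) (cd_mult \<gamma> n (cd_conj (cd_basis n k)) (cd_basis n l))"
    \<comment> \<open>The index shift can produce the unit, which conjugation fixes; then the sign
      comes from conjugating the other factor alone.\<close>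
    proof (cases "k = 0 \<or> l = 0")
      case True
      then show ?thesis using kl by (auto simp: cd_conj_basis)
    next
      case False
      then show ?thesis using kl Suc.IH[of l k] by (simp add: cd_conj_basis)
    qed
    then show ?thesis using 4 by (simp flip: k_def l_def)
  qed
qed auto

text \<open>The square laws and the flexible law are required at \<open>e\<close> only. The sign
  \<sigma> is kept variable because the unit (\<sigma> = 1) also occurs as a second
  coordinate.\<close>

definition cd_alternating ::
  "(nat \<Rightarrow> real) \<Rightarrow> nat \<Rightarrow> real \<Rightarrow> real \<Rightarrow> cd \<Rightarrow> bool" where
  "cd_alternating \<gamma> n \<sigma> \<mu> e \<longleftrightarrow>
     e \<in> cd_carrier n \<and> cd_conj e = cd_scale \<sigma> e \<and>
     (\<forall>x \<in> cd_carrier n.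
        cd_mult \<gamma> n e (cd_mult \<gamma> n e x) = cd_scale \<mu> x \<and>
        cd_mult \<gamma> n (cd_mult \<gamma> n x e) e = cd_scale \<mu> x \<and>
        cd_mult \<gamma> n e (cd_mult \<gamma> n x e) = cd_mult \<gamma> n (cd_mult \<gamma> n e x) e)"

text \<open>With L and R for multiplication by \<open>e\<close> on the left and right, (e,0) acts on
  (c,d) as (Lc, Rd) from the left and as (Rc, \<sigma>Rd) from the right; \<sigma> squares to
  1.\<close>

lemma cd_alternating_fst:
  assumes "cd_alternating \<gamma> n \<sigma> \<mu> e" "\<sigma> \<in> {1, - 1}"
  shows "cd_alternating \<gamma> (Suc n) \<sigma> \<mu> (Couple e (cd_zero n))"
  unfolding cd_alternating_def
proof (intro conjI ballI)
  fix x assume "x \<in> cd_carrier (Suc n)"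
  then obtain c d where x: "x = Couple c d" "c \<in> cd_carrier n" "d \<in> cd_carrier n"
    by (rule cd_carrier_SucE)
  show "cd_mult \<gamma> (Suc n) (Couple e (cd_zero n)) (cd_mult \<gamma> (Suc n) (Couple e (cd_zero n)) x) =
      cd_scale \<mu> x"
    using assms x by (auto simp: cd_alternating_def)
  show "cd_mult \<gamma> (Suc n) (cd_mult \<gamma> (Suc n) x (Couple e (cd_zero n))) (Couple e (cd_zero n)) =
      cd_scale \<mu> x"
    using assms x by (auto simp: cd_alternating_def)
  show "cd_mult \<gamma> (Suc n) (Couple e (cd_zero n)) (cd_mult \<gamma> (Suc n) x (Couple e (cd_zero n))) =
      cd_mult \<gamma> (Suc n) (cd_mult \<gamma> (Suc n) (Couple e (cd_zero n)) x) (Couple e (cd_zero n))"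
    using assms x by (auto simp: cd_alternating_def)
qed (use assms in \<open>auto simp: cd_alternating_def\<close>)

text \<open>Here (0,e) sends (c,d) to (\<gamma> d'e, ec') from the left and to (\<gamma>\<sigma> ed,
  ec) from the right, where ' is conjugation. As conjugation reverses products, each composite
  reduces to the laws for \<open>e\<close>, with one factor \<gamma>\<sigma> in the squares.\<close>

lemma cd_alternating_snd:
  assumes "cd_alternating \<gamma> n \<sigma> \<mu> e" "\<sigma> \<in> {1, - 1}"
  shows "cd_alternating \<gamma> (Suc n) (- 1) (\<gamma> n * \<sigma> * \<mu>) (Couple (cd_zero n) e)"
  unfolding cd_alternating_def
proof (intro conjI ballI)
  fix x assume "x \<in> cd_carrier (Suc n)"
  then obtain c d where x: "x = Couple c d" "c \<in> cd_carrier n" "d \<in> cd_carrier n"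
    by (rule cd_carrier_SucE)
  show "cd_mult \<gamma> (Suc n) (Couple (cd_zero n) e) (cd_mult \<gamma> (Suc n) (Couple (cd_zero n) e) x) =
      cd_scale (\<gamma> n * \<sigma> * \<mu>) x"
    using assms x by (auto simp: cd_alternating_def cd_conj_mult)
  show "cd_mult \<gamma> (Suc n) (cd_mult \<gamma> (Suc n) x (Couple (cd_zero n) e)) (Couple (cd_zero n) e) =
      cd_scale (\<gamma> n * \<sigma> * \<mu>) x"
    using assms x by (auto simp: cd_alternating_def cd_conj_mult)
  show "cd_mult \<gamma> (Suc n) (Couple (cd_zero n) e) (cd_mult \<gamma> (Suc n) x (Couple (cd_zero n) e)) =
      cd_mult \<gamma> (Suc n) (cd_mult \<gamma> (Suc n) (Couple (cd_zero n) e) x) (Couple (cd_zero n) e)"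
    using assms x by (auto simp: cd_alternating_def cd_conj_mult)
qed (use assms in \<open>auto simp: cd_alternating_def\<close>)

lemma cd_alternating_basis:
  assumes "\<And>k. \<gamma> k \<in> {1, - 1}"
  shows "\<exists>\<sigma> \<in> {1, - 1}. \<exists>\<mu> \<in> {1, - 1}. cd_alternating \<gamma> n \<sigma> \<mu> (cd_basis n j)"
proof (induction n arbitrary: j)
  case 0
  have "cd_alternating \<gamma> 0 1 1 (Scalar 1)" by (auto simp: cd_alternating_def)
  then show ?case by auto
next
  case (Suc n)
  show ?case
  proof (cases "j < 2 ^ n")
    case True
    obtain \<sigma> \<mu> where "\<sigma> \<in> {1, - 1}" "\<mu> \<in> {1, - 1}" "cd_alternating \<gamma> n \<sigma> \<mu> (cd_basis n j)"
      using Suc by blast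
    then show ?thesis using True cd_alternating_fst by fastforce
  next
    case False
    obtain \<sigma> \<mu> where *: "\<sigma> \<in> {1, - 1}" "\<mu> \<in> {1, - 1}"
      "cd_alternating \<gamma> n \<sigma> \<mu> (cd_basis n (j - 2 ^ n))"
      using Suc by blast
    have "\<gamma> n * \<sigma> * \<mu> \<in> {1, - 1}" using * assms[of n] by auto
    then show ?thesis using False cd_alternating_snd[OF *(3,1)] by auto
  qed
qed

text \<open>For \<open>\<gamma> n = - 1\<close>, annihilation of (a, \<epsilon>a) by (c,d) gives
  these two equations: directly if (c,d) is the left factor, and with \<open>cd_conj d\<close> in
  place of \<open>d\<close> if it is the right factor.\<close>

lemma cd_alternating_commutation_trivial:
  assumes a: "cd_alternating \<gamma> n \<sigma> \<mu> a" and \<mu>: "\<mu> \<noteq> 0" and \<epsilon>: "\<epsilon> \<in> {1, - 1}"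
    and c: "c \<in> cd_carrier n" and d: "d \<in> cd_carrier n"
    and ac: "cd_mult \<gamma> n a c = cd_scale \<epsilon> (cd_mult \<gamma> n d a)"
    and ca: "cd_mult \<gamma> n c a = cd_scale (- \<epsilon>) (cd_mult \<gamma> n a d)"
  shows "c = cd_zero n" "d = cd_zero n"
proof -
  have carr: "a \<in> cd_carrier n" using a by (simp add: cd_alternating_def)
  have "cd_mult \<gamma> n a (cd_mult \<gamma> n c a) = cd_scale (- \<epsilon> * \<mu>) d"
    using a carr d by (simp add: ca cd_alternating_def)
  moreover have "cd_mult \<gamma> n (cd_mult \<gamma> n a c) a = cd_scale (\<epsilon> * \<mu>) d"
    using a carr d by (simp add: ac cd_alternating_def)
  ultimately have "cd_scale (- \<epsilon> * \<mu>) d = cd_scale (\<epsilon> * \<mu>) d"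
    using a c by (simp add: cd_alternating_def)
  then show dz: "d = cd_zero n"
    using cd_scale_eq_iff[OF d] \<mu> \<epsilon> by fastforce
  then have "cd_mult \<gamma> n a (cd_mult \<gamma> n a c) = cd_zero n"
    using carr ac by simp
  then show "c = cd_zero n"
    using a c \<mu> by (simp add: cd_alternating_def cd_scale_eq_zero_iff)
qed

text \<open>Conjugation contributes \<sigma>, the square of \<open>a\<close> contributes \<mu>, and
  \<epsilon> cancels as its square is 1. Including \<epsilon> serves both numerator and denominator
  of \<open>cd_chi\<close>.\<close>

lemma cd_norm_alternating:
  assumes a: "cd_alternating \<gamma> n \<sigma> \<mu> a" and "\<epsilon> \<in> {1, - 1}"
  shows "cd_norm \<gamma> n (cd_scale \<epsilon> a) = \<sigma> * \<mu>"
proof -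
  have carr: "a \<in> cd_carrier n" using a by (simp add: cd_alternating_def)
  \<comment> \<open>The square law is evaluated at the unit; \<open>cd_mult_one\<close> is withheld
    so that the nested product survives for the law to match.\<close>
  have "cd_mult \<gamma> n a (cd_mult \<gamma> n a (cd_basis n 0)) = cd_scale \<mu> (cd_basis n 0)"
    using a by (simp add: cd_alternating_def del: cd_mult_one)
  then have "cd_mult \<gamma> n a a = cd_scale \<mu> (cd_basis n 0)"
    using carr by simp
  then have "cd_mult \<gamma> n (cd_scale \<epsilon> a) (cd_conj (cd_scale \<epsilon> a)) =
      cd_scale (\<sigma> * \<mu>) (cd_basis n 0)"
    using assms carr by (auto simp: cd_alternating_def)
  then show ?thesis
    by (simp add: cd_norm_def cd_scale_eq_iff[OF _ cd_basis_nonzero])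
qed

section \<open>Zero divisors and orthogonality for (a, \<epsilon>a)\<close>

theorem lemma6p9:
  fixes \<gamma> :: "nat \<Rightarrow> real" and n :: nat and a :: cd and \<epsilon> :: real
  assumes "\<And>k. \<gamma> k \<in> {1, - 1}"
    and "a \<in> cd_imag_basis n"
    and "\<epsilon> \<in> {1, - 1}"
  shows "cd_chi \<gamma> n a (cd_scale \<epsilon> a) = \<gamma> n \<and>
    (cd_zero_divisor \<gamma> (Suc n) (Couple a (cd_scale \<epsilon> a)) \<longleftrightarrow>
       cd_chi \<gamma> n a (cd_scale \<epsilon> a) = \<gamma> n \<and> \<gamma> n = 1) \<and>
    (\<gamma> n = 1 \<longrightarrow>
       cd_orthogonal \<gamma> (Suc n) (Couple a (cd_scale \<epsilon> a)) (Couple a (cd_scale \<epsilon> a)) \<and>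
       (\<forall>b \<in> cd_imag_basis n - {a}.
          cd_orthogonal \<gamma> (Suc n) (Couple a (cd_scale \<epsilon> a)) (Couple b (cd_scale (- \<epsilon>) b))))"
proof -
  obtain i where i: "0 < i" "i < 2 ^ n" "a = cd_basis n i"
    using assms(2) by (auto simp: cd_imag_basis_def Suc_le_eq)
  have carr: "a \<in> cd_carrier n" and nz: "a \<noteq> cd_zero n"
    using i cd_basis_nonzero by auto
  have conj: "cd_conj a = cd_scale (- 1) a"
    using i cd_conj_basis by simp
  obtain \<sigma> \<mu> where alt: "\<sigma> \<in> {1, - 1}" "\<mu> \<in> {1, - 1}" "cd_alternating \<gamma> n \<sigma> \<mu> a"
    using cd_alternating_basis[of \<gamma> n i] assms(1) unfolding i(3) by blast
  \<comment> \<open>Both norms equal \<sigma>\<mu>, which is nonzero, so the quotient is 1.\<close>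
  have chi: "cd_chi \<gamma> n a (cd_scale \<epsilon> a) = \<gamma> n"
    using cd_norm_alternating[OF alt(3), of 1] cd_norm_alternating[OF alt(3) assms(3)] alt(1,2)
    by (auto simp: cd_chi_def)
  \<comment> \<open>Since \<open>a\<close> is imaginary, the coordinates of the square are aa - aa
    and \<epsilon>(aa - aa).\<close>
  have self: "cd_orthogonal \<gamma> (Suc n) (Couple a (cd_scale \<epsilon> a)) (Couple a (cd_scale \<epsilon> a))"
    if "\<gamma> n = 1"
    using that assms(3) carr
    by (auto simp: cd_orthogonal_def conj cd_add_eq_zero_iff)
  have other: "cd_orthogonal \<gamma> (Suc n) (Couple a (cd_scale \<epsilon> a)) (Couple b (cd_scale (- \<epsilon>) b))"
    if \<gamma>: "\<gamma> n = 1" and b_in: "b \<in> cd_imag_basis n - {a}" for b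
  proof -
    obtain j where j: "0 < j" "j < 2 ^ n" "b = cd_basis n j"
      using b_in by (auto simp: cd_imag_basis_def Suc_le_eq)
    have "i \<noteq> j" using b_in i(3) j(3) by auto
    have b: "b \<in> cd_carrier n" "cd_conj b = cd_scale (- 1) b"
      using j cd_conj_basis by auto
    \<comment> \<open>In both orders, each coordinate of the product is ab + ba up to sign.\<close>
    have "cd_mult \<gamma> n a b = cd_scale (- 1) (cd_mult \<gamma> n b a)"
      unfolding i(3) j(3) using i(1,2) j(1,2) \<open>i \<noteq> j\<close> by (rule cd_basis_anticommute)
    then show ?thesis
      using \<gamma> assms(3) carr b by (auto simp: cd_orthogonal_def conj cd_add_eq_zero_iff)
  qed
  have "\<gamma> n = 1" if zd: "cd_zero_divisor \<gamma> (Suc n) (Couple a (cd_scale \<epsilon> a))"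
  proof (rule ccontr)
    assume "\<gamma> n \<noteq> 1"
    with assms(1)[of n] have \<gamma>: "\<gamma> n = - 1" by simp
    from zd obtain y where y: "y \<in> cd_carrier (Suc n)" "y \<noteq> cd_zero (Suc n)"
      "cd_mult \<gamma> (Suc n) (Couple a (cd_scale \<epsilon> a)) y = cd_zero (Suc n) \<or>
       cd_mult \<gamma> (Suc n) y (Couple a (cd_scale \<epsilon> a)) = cd_zero (Suc n)"
      by (auto simp only: cd_zero_divisor_def)
    from y(1) obtain c d where cd: "y = Couple c d" "c \<in> cd_carrier n" "d \<in> cd_carrier n"
      by (rule cd_carrier_SucE)
    have \<mu>: "\<mu> \<noteq> 0" using alt(2) by auto
    from y(3) show False
    proof
      assume *: "cd_mult \<gamma> (Suc n) (Couple a (cd_scale \<epsilon> a)) y = cd_zero (Suc n)"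
      have ac: "cd_mult \<gamma> n a c = cd_scale \<epsilon> (cd_mult \<gamma> n (cd_conj d) a)"
        using * carr cd \<gamma> by (simp add: cd_add_eq_zero_iff)
      have "cd_mult \<gamma> n d a = cd_scale (- \<epsilon>) (cd_mult \<gamma> n a (cd_conj c))"
        using * carr cd \<gamma> by (simp add: cd_add_eq_zero_iff)
      \<comment> \<open>The first coordinate involves \<open>c\<close> and \<open>cd_conj d\<close>,
        the second \<open>d\<close> and \<open>cd_conj c\<close>; conjugating the second puts both
        in the same unknowns.\<close>
      then have "cd_conj (cd_mult \<gamma> n d a) =
          cd_conj (cd_scale (- \<epsilon>) (cd_mult \<gamma> n a (cd_conj c)))"
        by simp
      then have "cd_scale (- 1) (cd_mult \<gamma> n a (cd_conj d)) = cd_scale \<epsilon> (cd_mult \<gamma> n c a)"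
        using carr cd by (simp add: cd_conj_mult conj)
      \<comment> \<open>Multiplying by \<epsilon>, its own inverse, isolates the product ca.\<close>
      then have "cd_scale \<epsilon> (cd_scale (- 1) (cd_mult \<gamma> n a (cd_conj d))) =
          cd_scale \<epsilon> (cd_scale \<epsilon> (cd_mult \<gamma> n c a))"
        by simp
      then have ca: "cd_mult \<gamma> n c a = cd_scale (- \<epsilon>) (cd_mult \<gamma> n a (cd_conj d))"
        using assms(3) by auto
      have "c = cd_zero n" "cd_conj d = cd_zero n"
        using cd_alternating_commutation_trivial[OF alt(3) \<mu> assms(3) _ _ ac ca] cd by auto
      then have "cd_conj (cd_conj d) = cd_zero n" "c = cd_zero n"
        by (simp_all only: cd_conj_zero)
      with y(2) cd show False by simp
    next
      assume *: "cd_mult \<gamma> (Suc n) y (Couple a (cd_scale \<epsilon> a)) = cd_zero (Suc n)"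
      have ca: "cd_mult \<gamma> n c a = cd_scale (- \<epsilon>) (cd_mult \<gamma> n a d)"
        using * carr cd \<gamma> by (simp add: cd_add_eq_zero_iff conj)
      have "cd_scale \<epsilon> (cd_mult \<gamma> n a c) = cd_mult \<gamma> n d a"
        using * carr cd by (simp add: cd_add_eq_zero_iff conj)
      then have "cd_scale \<epsilon> (cd_scale \<epsilon> (cd_mult \<gamma> n a c)) = cd_scale \<epsilon> (cd_mult \<gamma> n d a)"
        by simp
      then have ac: "cd_mult \<gamma> n a c = cd_scale \<epsilon> (cd_mult \<gamma> n d a)"
        using assms(3) by auto
      have "c = cd_zero n" "d = cd_zero n"
        using cd_alternating_commutation_trivial[OF alt(3) \<mu> assms(3) _ _ ac ca] cd by auto
      with y(2) cd show False by simp
    qed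
  qed
  \<comment> \<open>The element is its own annihilator, and it is nonzero because \<open>a\<close>
    is.\<close>
  moreover have "cd_zero_divisor \<gamma> (Suc n) (Couple a (cd_scale \<epsilon> a))" if "\<gamma> n = 1"
  proof -
    have "Couple a (cd_scale \<epsilon> a) \<in> cd_carrier (Suc n)" using carr by simp
    moreover have "Couple a (cd_scale \<epsilon> a) \<noteq> cd_zero (Suc n)" using nz by simp
    ultimately show ?thesis
      using self[OF that] unfolding cd_zero_divisor_def cd_orthogonal_def by blast
  qed
  ultimately show ?thesis using chi self other by blast
qed

end
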